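(* Let $M$ be a weakly o-minimal metric structure expanding a model of $\mathsf{UDLO}$, let $A \subseteq M$, and let $D \subseteq M$ be compact and $A$-definable. Then every $b \in D$ is $A$-definable. Consequently $\mathrm{acl}(A) = \mathrm{dcl}(A)$.
   Context: A metric linear order is a set with a linear order $\le$ and metric $d$ such that every open ball is order-convex, with ray predicate $r(x,y)=\inf_{z\le y}d(x,z)$. $\mathsf{UDLO}$ is the theory of complete metric linear orders of diameter $\le1$ with ultrametric metric such that for every $a$ both $\{d(a,b):b<a\}$ and $\{d(a,b):b>a\}$ are dense in $[0,1]$. A structure $M$ in a language containing $r$ that expands a metric linear order is weakly o-minimal if the interpretation of every definable predicate (with parameters) in one variable is weakly regulated, i.e. a uniform limit of functions in the $\mathbb{R}$-linear span of characteristic functions of order-convex subsets of $M$. A closed nonempty $D\subseteq M$ is $A$-definable if $d(x,D)$ is a definable predicate over $A$; $b$ is $A$-definable if $\{b\}$ is; $\mathrm{dcl}(A)$ is the set of $A$-definable points and $\mathrm{acl}(A)$ the set of points lying in some compact $A$-definable set. *)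

theory Defs
  imports "HOL-Analysis.Analysis"
begin

definition (in linorder) order_convex :: "'a set \<Rightarrow> bool" where
  "order_convex S \<longleftrightarrow> (\<forall>x\<in>S. \<forall>y\<in>S. \<forall>z. x \<le> z \<and> z \<le> y \<longrightarrow> z \<in> S)"

class metric_linear_order = linorder + metric_space +
  assumes order_convex_ball: "order_convex {b. dist a b < e}"

definition ray :: "'a::metric_linear_order \<Rightarrow> 'a \<Rightarrow> real" where
  "ray x y = (INF z\<in>{..y}. dist x z)"

class udlo = metric_linear_order + complete_space +
  assumes dist_le_one: "dist a b \<le> 1"
    and ultrametric: "dist a c \<le> max (dist a b) (dist b c)"
    and dense_dist_below: "{0..1} \<subseteq> closure {dist a b | b. b < a}"
    and dense_dist_above: "{0..1} \<subseteq> closure {dist a b | b. a < b}"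

text \<open>
  A metric structure in the sense of continuous logic, bundled with the arities of its
  signature. The universe is the type \<open>'m\<close>; the metric is \<open>dist\<close>; constants are function
  symbols of arity 0. Interpretations are only meaningful on lists of the right length.
  Moduli of uniform continuity are not recorded, only their existence is required
  (in \<open>is_metric_structure\<close>), since they play no role for a single structure.
\<close>

record ('m, 'f, 'p) metric_structure =
  fun_arity :: "'f \<Rightarrow> nat"
  pred_arity :: "'p \<Rightarrow> nat"
  fun_interp :: "'f \<Rightarrow> 'm list \<Rightarrow> 'm"
  pred_interp :: "'p \<Rightarrow> 'm list \<Rightarrow> real"

definition uniformly_continuous_nary ::
    "nat \<Rightarrow> ('a::metric_space list \<Rightarrow> 'b::metric_space) \<Rightarrow> bool" where
  "uniformly_continuous_nary n f \<longleftrightarrow>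
    (\<forall>\<epsilon>>0. \<exists>\<delta>>0. \<forall>xs ys. length xs = n \<and> length ys = n \<and>
       (\<forall>i<n. dist (xs ! i) (ys ! i) < \<delta>) \<longrightarrow> dist (f xs) (f ys) < \<epsilon>)"

definition is_metric_structure :: "('m::complete_space, 'f, 'p) metric_structure \<Rightarrow> bool" where
  "is_metric_structure M \<longleftrightarrow>
    (\<forall>x y::'m. dist x y \<le> 1) \<and>
    (\<forall>f. uniformly_continuous_nary (fun_arity M f) (fun_interp M f)) \<and>
    (\<forall>p. uniformly_continuous_nary (pred_arity M p) (pred_interp M p)) \<and>
    (\<forall>p xs. length xs = pred_arity M p \<longrightarrow> pred_interp M p xs \<in> {0..1})"

text \<open>
  \<open>Param a\<close> is the constant symbol naming the element \<open>a\<close> of the structure. In \<open>Conn u \<phi>s\<close>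
  the connective \<open>u\<close> is meant as a continuous function from \<open>[0,1]\<^sup>n\<close> to \<open>[0,1]\<close> with
  \<open>n = length \<phi>s\<close>, where \<open>[0,1]\<^sup>n\<close> is represented as a \<open>PiE\<close> with the product topology.
\<close>

datatype ('m, 'f) tm = Var nat | Param 'm | Fun 'f "('m, 'f) tm list"

datatype ('m, 'f, 'p) fm =
    Dist "('m, 'f) tm" "('m, 'f) tm"
  | Pred 'p "('m, 'f) tm list"
  | Conn "(nat \<Rightarrow> real) \<Rightarrow> real" "('m, 'f, 'p) fm list"
  | QSup nat "('m, 'f, 'p) fm"
  | QInf nat "('m, 'f, 'p) fm"

definition unit_cube :: "nat \<Rightarrow> (nat \<Rightarrow> real) set" where
  "unit_cube n = (\<Pi>\<^sub>E i\<in>{..<n}. {0..1})"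

fun tm_over :: "('m, 'f, 'p) metric_structure \<Rightarrow> 'm set \<Rightarrow> ('m, 'f) tm \<Rightarrow> bool" where
  "tm_over M A (Var i) \<longleftrightarrow> True"
| "tm_over M A (Param a) \<longleftrightarrow> a \<in> A"
| "tm_over M A (Fun f ts) \<longleftrightarrow> length ts = fun_arity M f \<and> (\<forall>t\<in>set ts. tm_over M A t)"

fun fm_over :: "('m, 'f, 'p) metric_structure \<Rightarrow> 'm set \<Rightarrow> ('m, 'f, 'p) fm \<Rightarrow> bool" where
  "fm_over M A (Dist s t) \<longleftrightarrow> tm_over M A s \<and> tm_over M A t"
| "fm_over M A (Pred p ts) \<longleftrightarrow> length ts = pred_arity M p \<and> (\<forall>t\<in>set ts. tm_over M A t)"
| "fm_over M A (Conn u \<phi>s) \<longleftrightarrow>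
     continuous_on (unit_cube (length \<phi>s)) u \<and> u ` unit_cube (length \<phi>s) \<subseteq> {0..1} \<and>
     (\<forall>\<phi>\<in>set \<phi>s. fm_over M A \<phi>)"
| "fm_over M A (QSup i \<phi>) \<longleftrightarrow> fm_over M A \<phi>"
| "fm_over M A (QInf i \<phi>) \<longleftrightarrow> fm_over M A \<phi>"

fun tm_vars :: "('m, 'f) tm \<Rightarrow> nat set" where
  "tm_vars (Var i) = {i}"
| "tm_vars (Param a) = {}"
| "tm_vars (Fun f ts) = (\<Union>t\<in>set ts. tm_vars t)"

fun free_vars :: "('m, 'f, 'p) fm \<Rightarrow> nat set" where
  "free_vars (Dist s t) = tm_vars s \<union> tm_vars t"
| "free_vars (Pred p ts) = (\<Union>t\<in>set ts. tm_vars t)"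
| "free_vars (Conn u \<phi>s) = (\<Union>\<phi>\<in>set \<phi>s. free_vars \<phi>)"
| "free_vars (QSup i \<phi>) = free_vars \<phi> - {i}"
| "free_vars (QInf i \<phi>) = free_vars \<phi> - {i}"

fun tm_val :: "('m, 'f, 'p) metric_structure \<Rightarrow> (nat \<Rightarrow> 'm) \<Rightarrow> ('m, 'f) tm \<Rightarrow> 'm" where
  "tm_val M e (Var i) = e i"
| "tm_val M e (Param a) = a"
| "tm_val M e (Fun f ts) = fun_interp M f (map (tm_val M e) ts)"

fun fm_val ::
    "('m::metric_space, 'f, 'p) metric_structure \<Rightarrow> (nat \<Rightarrow> 'm) \<Rightarrow> ('m, 'f, 'p) fm \<Rightarrow> real" where
  "fm_val M e (Dist s t) = dist (tm_val M e s) (tm_val M e t)"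
| "fm_val M e (Pred p ts) = pred_interp M p (map (tm_val M e) ts)"
| "fm_val M e (Conn u \<phi>s) = u (\<lambda>i\<in>{..<length \<phi>s}. map (fm_val M e) \<phi>s ! i)"
| "fm_val M e (QSup i \<phi>) = (SUP a. fm_val M (e(i := a)) \<phi>)"
| "fm_val M e (QInf i \<phi>) = (INF a. fm_val M (e(i := a)) \<phi>)"

text \<open>
  Definable predicates in one variable, the variable being \<open>Var 0\<close>. The values of the
  assignment at the other variables are irrelevant.
\<close>

definition definable_pred ::
    "('m::metric_space, 'f, 'p) metric_structure \<Rightarrow> 'm set \<Rightarrow> ('m \<Rightarrow> real) \<Rightarrow> bool" where
  "definable_pred M A P \<longleftrightarrow>
    (\<exists>\<phi>. (\<forall>k. fm_over M A (\<phi> k) \<and> free_vars (\<phi> k) \<subseteq> {0}) \<and>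
         uniform_limit UNIV (\<lambda>k x. fm_val M (\<lambda>_. x) (\<phi> k)) P sequentially)"

definition definable_set ::
    "('m::metric_space, 'f, 'p) metric_structure \<Rightarrow> 'm set \<Rightarrow> 'm set \<Rightarrow> bool" where
  "definable_set M A D \<longleftrightarrow> closed D \<and> D \<noteq> {} \<and> definable_pred M A (\<lambda>x. infdist x D)"

definition definable_point ::
    "('m::metric_space, 'f, 'p) metric_structure \<Rightarrow> 'm set \<Rightarrow> 'm \<Rightarrow> bool" where
  "definable_point M A b \<longleftrightarrow> definable_set M A {b}"

definition dcl :: "('m::metric_space, 'f, 'p) metric_structure \<Rightarrow> 'm set \<Rightarrow> 'm set" where
  "dcl M A = {b. definable_point M A b}"

definition acl :: "('m::metric_space, 'f, 'p) metric_structure \<Rightarrow> 'm set \<Rightarrow> 'm set" where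
  "acl M A = {b. \<exists>D. compact D \<and> definable_set M A D \<and> b \<in> D}"

definition convex_step_function :: "('m::linorder \<Rightarrow> real) \<Rightarrow> bool" where
  "convex_step_function g \<longleftrightarrow>
    (\<exists>\<C> c. finite \<C> \<and> (\<forall>C\<in>\<C>. order_convex C) \<and> g = (\<lambda>x. \<Sum>C\<in>\<C>. c C * indicator C x))"

definition weakly_regulated :: "('m::linorder \<Rightarrow> real) \<Rightarrow> bool" where
  "weakly_regulated f \<longleftrightarrow>
    (\<exists>g. (\<forall>n. convex_step_function (g n)) \<and> uniform_limit UNIV g f sequentially)"

definition has_ray_symbol ::
    "('m::metric_linear_order, 'f, 'p) metric_structure \<Rightarrow> bool" where
  "has_ray_symbol M \<longleftrightarrow>
    (\<exists>\<rho>. pred_arity M \<rho> = 2 \<and> (\<forall>x y. pred_interp M \<rho> [x, y] = ray x y))"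

definition weakly_o_minimal ::
    "('m::{metric_linear_order, complete_space}, 'f, 'p) metric_structure \<Rightarrow> bool" where
  "weakly_o_minimal M \<longleftrightarrow>
    is_metric_structure M \<and> has_ray_symbol M \<and>
    (\<forall>P. definable_pred M UNIV P \<longrightarrow> weakly_regulated P)"

end

theory Submission imports Defs begin

text \<open>
  A greatest element \<open>b\<close> of an \<open>A\<close>-definable set \<open>D\<close> is \<open>A\<close>-definable: \<open>d(x,b)\<close> is the maximum of
  \<open>d(x,D)\<close> and \<open>r(b,x)\<close>, and \<open>r(b,x)\<close> is the supremum of \<open>r(y,x)\<close> over \<open>y \<in> D\<close>, a quantification
  over a definable set. If \<open>c\<close> is \<open>A\<close>-definable and \<open>D\<close> is compact, then \<open>D\<close> minus the open
  \<open>\<epsilon>\<close>-ball around \<open>c\<close> is again \<open>A\<close>-definable: balls are clopen in an ultrametric space, so the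
  distances from \<open>c\<close> to points of \<open>D\<close> omit an interval just below \<open>\<epsilon>\<close>. Now cover the \<open>A\<close>-definable
  points of a compact \<open>A\<close>-definable set by finitely many \<open>\<epsilon>\<close>-balls around such points. Nothing is left
  over, since the leftover would have a greatest element, an uncovered \<open>A\<close>-definable point. Hence the
  \<open>A\<close>-definable points are dense in the set, and they form a closed set.
\<close>

section \<open>Values, free variables and renaming\<close>

lemma fm_val_in_unit:
  fixes M :: "('m::complete_space, 'f, 'p) metric_structure"
  assumes "is_metric_structure M" "fm_over M A \<phi>"
  shows "fm_val M e \<phi> \<in> {0..1}"
  using assms(2)
proof (induction \<phi> arbitrary: e)
  case (Dist s t)
  then show ?case using assms(1) by (simp add: is_metric_structure_def)
next
  case (Pred p ts)
  then have "length (map (tm_val M e) ts) = pred_arity M p" by simp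
  then show ?case using assms(1) unfolding is_metric_structure_def fm_val.simps by blast
next
  case (Conn u \<phi>s)
  have "(\<lambda>i\<in>{..<length \<phi>s}. map (fm_val M e) \<phi>s ! i) \<in> unit_cube (length \<phi>s)"
    using Conn by (auto simp: unit_cube_def)
  then show ?case using Conn.prems by (simp add: image_subset_iff)
next
  case (QSup i \<phi>)
  then have range: "range (\<lambda>a. fm_val M (e(i := a)) \<phi>) \<subseteq> {0..1}" by auto
  have "Sup (range (\<lambda>a. fm_val M (e(i := a)) \<phi>)) \<in> {0..1}"
    using range bdd_above_mono[OF bdd_above_Icc range]
    by (intro closed_subset_contains_Sup[OF closed_atLeastAtMost]) auto
  then show ?case by simp
next
  case (QInf i \<phi>)
  then have range: "range (\<lambda>a. fm_val M (e(i := a)) \<phi>) \<subseteq> {0..1}" by auto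
  have "Inf (range (\<lambda>a. fm_val M (e(i := a)) \<phi>)) \<in> {0..1}"
    using range by (intro atLeastAtMost_subset_contains_Inf) auto
  then show ?case by simp
qed

lemma tm_val_cong:
  assumes "\<And>i. i \<in> tm_vars t \<Longrightarrow> e i = e' i"
  shows "tm_val M e t = tm_val M e' t"
  using assms
proof (induction t)
  case (Fun f ts)
  then have "map (tm_val M e) ts = map (tm_val M e') ts"
    by (intro map_cong) auto
  then show ?case by (simp only: tm_val.simps)
qed auto

lemma fm_val_cong:
  assumes "\<And>i. i \<in> free_vars \<phi> \<Longrightarrow> e i = e' i"
  shows "fm_val M e \<phi> = fm_val M e' \<phi>"
  using assms
proof (induction \<phi> arbitrary: e e')
  case (Dist s t)
  then have "tm_val M e s = tm_val M e' s" "tm_val M e t = tm_val M e' t"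
    by (auto intro!: tm_val_cong)
  then show ?case by simp
next
  case (Pred p ts)
  then have "map (tm_val M e) ts = map (tm_val M e') ts"
    by (intro map_cong refl tm_val_cong) auto
  then show ?case by (simp only: fm_val.simps)
next
  case (Conn u \<phi>s)
  have "fm_val M e \<phi> = fm_val M e' \<phi>" if "\<phi> \<in> set \<phi>s" for \<phi>
    by (rule Conn.IH[OF that]) (use that Conn.prems in auto)
  then have "map (fm_val M e) \<phi>s = map (fm_val M e') \<phi>s"
    by (rule map_cong[OF refl])
  then show ?case by (simp only: fm_val.simps)
next
  case (QSup i \<phi>)
  have "fm_val M (e(i := a)) \<phi> = fm_val M (e'(i := a)) \<phi>" for a
    by (rule QSup.IH) (use QSup.prems in auto)
  then show ?case by (simp only: fm_val.simps)
next
  case (QInf i \<phi>)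
  have "fm_val M (e(i := a)) \<phi> = fm_val M (e'(i := a)) \<phi>" for a
    by (rule QInf.IH) (use QInf.prems in auto)
  then show ?case by (simp only: fm_val.simps)
qed

primrec rename_tm :: "(nat \<Rightarrow> nat) \<Rightarrow> ('m, 'f) tm \<Rightarrow> ('m, 'f) tm" where
  "rename_tm \<pi> (Var i) = Var (\<pi> i)"
| "rename_tm \<pi> (Param a) = Param a"
| "rename_tm \<pi> (Fun f ts) = Fun f (map (rename_tm \<pi>) ts)"

text \<open>Bound variables are renamed as well, so that an injective renaming captures no variable.\<close>

primrec rename_fm :: "(nat \<Rightarrow> nat) \<Rightarrow> ('m, 'f, 'p) fm \<Rightarrow> ('m, 'f, 'p) fm" where
  "rename_fm \<pi> (Dist s t) = Dist (rename_tm \<pi> s) (rename_tm \<pi> t)"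
| "rename_fm \<pi> (Pred p ts) = Pred p (map (rename_tm \<pi>) ts)"
| "rename_fm \<pi> (Conn u \<phi>s) = Conn u (map (rename_fm \<pi>) \<phi>s)"
| "rename_fm \<pi> (QSup i \<phi>) = QSup (\<pi> i) (rename_fm \<pi> \<phi>)"
| "rename_fm \<pi> (QInf i \<phi>) = QInf (\<pi> i) (rename_fm \<pi> \<phi>)"

lemma tm_over_rename: "tm_over M A (rename_tm \<pi> t) \<longleftrightarrow> tm_over M A t"
  by (induction t) auto

lemma tm_vars_rename: "tm_vars (rename_tm \<pi> t) = \<pi> ` tm_vars t"
  by (induction t) auto

lemma tm_val_rename: "tm_val M e (rename_tm \<pi> t) = tm_val M (e \<circ> \<pi>) t"
proof (induction t)
  case (Fun f ts)
  then have "map (tm_val M e \<circ> rename_tm \<pi>) ts = map (tm_val M (e \<circ> \<pi>)) ts"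
    by (simp add: comp_def)
  then show ?case by (simp only: rename_tm.simps tm_val.simps map_map)
qed auto

lemma fm_over_rename: "fm_over M A (rename_fm \<pi> \<phi>) \<longleftrightarrow> fm_over M A \<phi>"
  by (induction \<phi>) (auto simp: tm_over_rename)

lemma free_vars_rename: "inj \<pi> \<Longrightarrow> free_vars (rename_fm \<pi> \<phi>) = \<pi> ` free_vars \<phi>"
  by (induction \<phi>) (auto simp: tm_vars_rename image_set_diff)

lemma fm_val_rename:
  assumes "inj \<pi>"
  shows "fm_val M e (rename_fm \<pi> \<phi>) = fm_val M (e \<circ> \<pi>) \<phi>"
proof (induction \<phi> arbitrary: e)
  case (Pred p ts)
  have "map (tm_val M e \<circ> rename_tm \<pi>) ts = map (tm_val M (e \<circ> \<pi>)) ts"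
    by (simp add: tm_val_rename)
  then show ?case by (simp only: rename_fm.simps fm_val.simps map_map)
next
  case (Conn u \<phi>s)
  then have "map (fm_val M e \<circ> rename_fm \<pi>) \<phi>s = map (fm_val M (e \<circ> \<pi>)) \<phi>s"
    by (simp add: comp_def)
  then show ?case by (simp only: rename_fm.simps fm_val.simps map_map length_map)
next
  case (QSup i \<phi>)
  have "e(\<pi> i := a) \<circ> \<pi> = (e \<circ> \<pi>)(i := a)" for a
    using assms by (auto simp: inj_eq)
  then show ?case by (simp only: rename_fm.simps fm_val.simps QSup.IH)
next
  case (QInf i \<phi>)
  have "e(\<pi> i := a) \<circ> \<pi> = (e \<circ> \<pi>)(i := a)" for a
    using assms by (auto simp: inj_eq)
  then show ?case by (simp only: rename_fm.simps fm_val.simps QInf.IH)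
qed (simp add: tm_val_rename)

section \<open>Definable predicates in several variables\<close>

definition definable_in_vars ::
    "('m::metric_space, 'f, 'p) metric_structure \<Rightarrow> 'm set \<Rightarrow> nat set \<Rightarrow> ((nat \<Rightarrow> 'm) \<Rightarrow> real) \<Rightarrow> bool"
  where "definable_in_vars M A V P \<longleftrightarrow>
    (\<exists>\<phi>. (\<forall>k. fm_over M A (\<phi> k) \<and> free_vars (\<phi> k) \<subseteq> V) \<and>
         uniform_limit UNIV (\<lambda>k e. fm_val M e (\<phi> k)) P sequentially)"

lemma definable_in_varsI:
  assumes "\<And>k. fm_over M A (\<phi> k)" "\<And>k. free_vars (\<phi> k) \<subseteq> V"
    and "uniform_limit UNIV (\<lambda>k e. fm_val M e (\<phi> k)) P sequentially"
  shows "definable_in_vars M A V P"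
  using assms unfolding definable_in_vars_def by blast

lemma definable_in_varsE:
  assumes "definable_in_vars M A V P"
  obtains \<phi> where "\<And>k. fm_over M A (\<phi> k)" "\<And>k. free_vars (\<phi> k) \<subseteq> V"
    "uniform_limit UNIV (\<lambda>k e. fm_val M e (\<phi> k)) P sequentially"
  using assms unfolding definable_in_vars_def by blast

lemma definable_in_vars_mono:
  "definable_in_vars M A V P \<Longrightarrow> V \<subseteq> W \<Longrightarrow> definable_in_vars M A W P"
  unfolding definable_in_vars_def by (meson subset_trans)

lemma definable_in_vars_fm_val:
  "fm_over M A \<phi> \<Longrightarrow> free_vars \<phi> \<subseteq> V \<Longrightarrow> definable_in_vars M A V (\<lambda>e. fm_val M e \<phi>)"
  by (rule definable_in_varsI[of M A "\<lambda>_. \<phi>"]) (auto intro: uniform_limit_const)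

lemma definable_in_vars_dist: "definable_in_vars M A {i, j} (\<lambda>e. dist (e i) (e j))"
  using definable_in_vars_fm_val[of M A "Dist (Var i) (Var j)"] by simp

lemma definable_in_vars_ray:
  assumes "has_ray_symbol M"
  shows "definable_in_vars M A {i, j} (\<lambda>e. ray (e i) (e j))"
proof -
  obtain \<rho> where "pred_arity M \<rho> = 2" "\<And>x y. pred_interp M \<rho> [x, y] = ray x y"
    using assms unfolding has_ray_symbol_def by blast
  then show ?thesis
    using definable_in_vars_fm_val[of M A "Pred \<rho> [Var i, Var j]"] by simp
qed

lemma definable_in_vars_rename:
  assumes "inj \<pi>" "definable_in_vars M A V P"
  shows "definable_in_vars M A (\<pi> ` V) (\<lambda>e. P (e \<circ> \<pi>))"
proof -
  obtain \<phi> where over: "\<And>k. fm_over M A (\<phi> k)" and free: "\<And>k. free_vars (\<phi> k) \<subseteq> V"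
    and lim: "uniform_limit UNIV (\<lambda>k e. fm_val M e (\<phi> k)) P sequentially"
    using assms(2) by (rule definable_in_varsE) blast
  have "uniform_limit UNIV (\<lambda>k e. fm_val M (e \<circ> \<pi>) (\<phi> k)) (\<lambda>e. P (e \<circ> \<pi>)) sequentially"
    using lim by (rule uniform_limit_compose') simp
  then have "uniform_limit UNIV (\<lambda>k e. fm_val M e (rename_fm \<pi> (\<phi> k)))
      (\<lambda>e. P (e \<circ> \<pi>)) sequentially"
    by (simp add: fm_val_rename[OF assms(1)])
  then show ?thesis
    by (rule definable_in_varsI[rotated 2])
      (use over free in \<open>auto simp: fm_over_rename free_vars_rename[OF assms(1)]\<close>)
qed

lemma definable_pred_iff_Var_0:
  "definable_pred M A P \<longleftrightarrow> definable_in_vars M A {0} (\<lambda>e. P (e 0))"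
proof -
  have equiv: "uniform_limit UNIV (\<lambda>k x. fm_val M (\<lambda>_. x) (\<phi> k)) P sequentially \<longleftrightarrow>
      uniform_limit UNIV (\<lambda>k e. fm_val M e (\<phi> k)) (\<lambda>e. P (e 0)) sequentially"
    (is "?unary \<longleftrightarrow> ?assignments") if free: "\<forall>k. free_vars (\<phi> k) \<subseteq> {0}" for \<phi>
  proof
    assume ?unary
    then have const: "uniform_limit UNIV (\<lambda>k e. fm_val M (\<lambda>_. e 0) (\<phi> k))
        (\<lambda>e. P (e 0)) sequentially"
      by (rule uniform_limit_compose') simp
    show ?assignments
      by (rule uniform_limit_cong'[THEN iffD1, OF _ refl const])
        (use free in \<open>auto intro!: fm_val_cong\<close>)
  next
    assume ?assignments
    from uniform_limit_compose'[OF this, of "\<lambda>x _. x" UNIV] show ?unary by simp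
  qed
  show ?thesis
    unfolding definable_pred_def definable_in_vars_def
    by (intro ex_cong1 conj_cong refl equiv) simp
qed

lemma definable_pred_iff:
  "definable_pred M A P \<longleftrightarrow> definable_in_vars M A {i} (\<lambda>e. P (e i))"
proof -
  have "definable_in_vars M A {k} (\<lambda>e. P (e k))"
    if "definable_in_vars M A {j} (\<lambda>e. P (e j))" for j k
    using definable_in_vars_rename[OF inj_transpose that, of j k] by simp
  then show ?thesis unfolding definable_pred_iff_Var_0 by blast
qed

lemma definable_in_vars_in_unit:
  fixes M :: "('m::complete_space, 'f, 'p) metric_structure"
  assumes "is_metric_structure M" "definable_in_vars M A V P"
  shows "P e \<in> {0..1}"
proof -
  obtain \<phi> where over: "\<And>k. fm_over M A (\<phi> k)"
    and lim: "uniform_limit UNIV (\<lambda>k e. fm_val M e (\<phi> k)) P sequentially"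
    using assms(2) by (rule definable_in_varsE) blast
  have "(\<lambda>k. fm_val M e (\<phi> k)) \<longlonglongrightarrow> P e"
    using lim by (rule tendsto_uniform_limitI) simp
  then show ?thesis
    by (rule closed_sequentially[OF closed_atLeastAtMost, rotated])
      (use fm_val_in_unit[OF assms(1) over] in blast)
qed

lemma definable_in_vars_uniform_limit:
  assumes Q_definable: "\<And>n. definable_in_vars M A V (Q n)"
    and lim: "uniform_limit UNIV Q P sequentially"
  shows "definable_in_vars M A V P"
proof -
  have "\<exists>\<phi>. fm_over M A \<phi> \<and> free_vars \<phi> \<subseteq> V \<and>
      (\<forall>e. dist (fm_val M e \<phi>) (Q n e) < inverse (real (Suc n)))" for n
  proof -
    obtain \<phi> where over: "\<And>k. fm_over M A (\<phi> k)" and free: "\<And>k. free_vars (\<phi> k) \<subseteq> V"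
      and lim_n: "uniform_limit UNIV (\<lambda>k e. fm_val M e (\<phi> k)) (Q n) sequentially"
      using Q_definable[of n] by (rule definable_in_varsE) blast
    obtain k where "\<forall>e\<in>UNIV. dist (fm_val M e (\<phi> k)) (Q n e) < inverse (real (Suc n))"
      using eventually_happens'[OF _ uniform_limitD[OF lim_n, of "inverse (real (Suc n))"]]
      by auto
    then show ?thesis using over free by (intro exI[of _ "\<phi> k"]) simp
  qed
  then obtain \<phi> where over: "\<And>n. fm_over M A (\<phi> n)" and free: "\<And>n. free_vars (\<phi> n) \<subseteq> V"
    and close: "\<And>n e. dist (fm_val M e (\<phi> n)) (Q n e) < inverse (real (Suc n))"
    by metis
  have "uniform_limit UNIV (\<lambda>n e. fm_val M e (\<phi> n)) P sequentially"
  proof (rule uniform_limitI)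
    fix \<epsilon> :: real assume "\<epsilon> > 0"
    have "\<forall>\<^sub>F n in sequentially. inverse (real (Suc n)) < \<epsilon> / 2"
      by (rule order_tendstoD(2)[OF LIMSEQ_inverse_real_of_nat]) (use \<open>\<epsilon> > 0\<close> in simp)
    moreover have "\<forall>\<^sub>F n in sequentially. \<forall>e\<in>UNIV. dist (Q n e) (P e) < \<epsilon> / 2"
      by (rule uniform_limitD[OF lim]) (use \<open>\<epsilon> > 0\<close> in simp)
    ultimately show "\<forall>\<^sub>F n in sequentially. \<forall>e\<in>UNIV. dist (fm_val M e (\<phi> n)) (P e) < \<epsilon>"
    proof eventually_elim
      case (elim n)
      have "dist (fm_val M e (\<phi> n)) (P e) < \<epsilon>" for e
      proof -
        have "dist (Q n e) (P e) < \<epsilon> / 2" using elim(2) by blast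
        then show ?thesis
          using close[of e n] elim(1) dist_triangle[of "fm_val M e (\<phi> n)" "P e" "Q n e"]
          by linarith
      qed
      then show ?case by blast
    qed
  qed
  then show ?thesis by (rule definable_in_varsI[OF over free])
qed

definition conn2 ::
    "(real \<Rightarrow> real \<Rightarrow> real) \<Rightarrow> ('m, 'f, 'p) fm \<Rightarrow> ('m, 'f, 'p) fm \<Rightarrow> ('m, 'f, 'p) fm" where
  "conn2 u \<phi> \<psi> = Conn (\<lambda>f. u (f 0) (f 1)) [\<phi>, \<psi>]"

lemma fm_val_conn2: "fm_val M e (conn2 u \<phi> \<psi>) = u (fm_val M e \<phi>) (fm_val M e \<psi>)"
  by (simp add: conn2_def)

lemma free_vars_conn2: "free_vars (conn2 u \<phi> \<psi>) = free_vars \<phi> \<union> free_vars \<psi>"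
  by (simp add: conn2_def)

lemma fm_over_conn2:
  assumes cont: "continuous_on ({0..1} \<times> {0..1}) (\<lambda>(s, t). u s t)"
    and range: "\<And>s t. s \<in> {0..1} \<Longrightarrow> t \<in> {0..1} \<Longrightarrow> u s t \<in> {0..1}"
    and "fm_over M A \<phi>" "fm_over M A \<psi>"
  shows "fm_over M A (conn2 u \<phi> \<psi>)"
proof -
  have square: "(f 0, f 1) \<in> {0..1} \<times> {0..1}" if "f \<in> unit_cube 2" for f
    using that unfolding unit_cube_def by (auto simp: PiE_iff)
  have "continuous_on (unit_cube 2) (\<lambda>f. (f (0::nat), f 1))"
    by (intro continuous_on_Pair continuous_on_subset[OF continuous_on_product_coordinates]) auto
  then have "continuous_on (unit_cube 2) (\<lambda>f. case (f 0, f 1) of (s, t) \<Rightarrow> u s t)"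
    by (rule continuous_on_compose2[OF cont]) (rule image_subsetI[OF square])
  then have "continuous_on (unit_cube 2) (\<lambda>f. u (f 0) (f 1))" by simp
  moreover have "u (f 0) (f 1) \<in> {0..1}" if "f \<in> unit_cube 2" for f
    using square[OF that] by (intro range) auto
  ultimately show ?thesis
    using assms(3,4) by (simp add: conn2_def numeral_2_eq_2 image_subset_iff)
qed

lemma uniform_limit_Pair:
  assumes "uniform_limit X f l F" "uniform_limit X g m F"
  shows "uniform_limit X (\<lambda>n x. (f n x, g n x)) (\<lambda>x. (l x, m x)) F"
proof (rule uniform_limitI)
  fix \<epsilon> :: real assume "\<epsilon> > 0"
  then have "\<forall>\<^sub>F n in F. \<forall>x\<in>X. dist (f n x) (l x) < \<epsilon> / 2"
    and "\<forall>\<^sub>F n in F. \<forall>x\<in>X. dist (g n x) (m x) < \<epsilon> / 2"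
    using uniform_limitD[OF assms(1), of "\<epsilon> / 2"] uniform_limitD[OF assms(2), of "\<epsilon> / 2"]
    by simp_all
  then show "\<forall>\<^sub>F n in F. \<forall>x\<in>X. dist (f n x, g n x) (l x, m x) < \<epsilon>"
  proof eventually_elim
    case (elim n)
    show ?case
    proof
      fix x assume "x \<in> X"
      then have "dist (f n x) (l x) < \<epsilon> / 2" "dist (g n x) (m x) < \<epsilon> / 2" using elim by auto
      moreover have "dist (f n x, g n x) (l x, m x) \<le> dist (f n x) (l x) + dist (g n x) (m x)"
        unfolding dist_Pair_Pair by (intro sqrt_sum_squares_le_sum) auto
      ultimately show "dist (f n x, g n x) (l x, m x) < \<epsilon>" by linarith
    qed
  qed
qed

lemma definable_in_vars_conn2:
  fixes M :: "('m::complete_space, 'f, 'p) metric_structure"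
  assumes metric_structure: "is_metric_structure M"
    and P_definable: "definable_in_vars M A V P" and Q_definable: "definable_in_vars M A V Q"
    and cont: "continuous_on ({0..1} \<times> {0..1}) (\<lambda>(s, t). u s t)"
    and range: "\<And>s t. s \<in> {0..1} \<Longrightarrow> t \<in> {0..1} \<Longrightarrow> u s t \<in> {0..1}"
  shows "definable_in_vars M A V (\<lambda>e. u (P e) (Q e))"
proof -
  obtain \<phi> where \<phi>_over: "\<And>k. fm_over M A (\<phi> k)" and \<phi>_free: "\<And>k. free_vars (\<phi> k) \<subseteq> V"
    and \<phi>_lim: "uniform_limit UNIV (\<lambda>k e. fm_val M e (\<phi> k)) P sequentially"
    using P_definable by (rule definable_in_varsE) blast
  obtain \<psi> where \<psi>_over: "\<And>k. fm_over M A (\<psi> k)" and \<psi>_free: "\<And>k. free_vars (\<psi> k) \<subseteq> V"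
    and \<psi>_lim: "uniform_limit UNIV (\<lambda>k e. fm_val M e (\<psi> k)) Q sequentially"
    using Q_definable by (rule definable_in_varsE) blast
  have "uniformly_continuous_on ({0..1} \<times> {0..1}) (\<lambda>(s, t). u s t)"
    using cont by (intro compact_uniformly_continuous compact_Times) auto
  from uniform_limit_compose_uniformly_continuous_on
    [OF uniform_limit_Pair[OF \<phi>_lim \<psi>_lim] this _ closed_Times]
  have "uniform_limit UNIV (\<lambda>k e. fm_val M e (conn2 u (\<phi> k) (\<psi> k)))
      (\<lambda>e. u (P e) (Q e)) sequentially"
    using fm_val_in_unit[OF metric_structure \<phi>_over] fm_val_in_unit[OF metric_structure \<psi>_over]
    by (simp add: fm_val_conn2)
  moreover have "fm_over M A (conn2 u (\<phi> k) (\<psi> k))" for k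
    by (rule fm_over_conn2[OF cont range \<phi>_over \<psi>_over])
  moreover have "free_vars (conn2 u (\<phi> k) (\<psi> k)) \<subseteq> V" for k
    using \<phi>_free \<psi>_free by (simp add: free_vars_conn2)
  ultimately show ?thesis
    by (intro definable_in_varsI[of M A "\<lambda>k. conn2 u (\<phi> k) (\<psi> k)"])
qed

lemma definable_in_vars_conn1:
  fixes M :: "('m::complete_space, 'f, 'p) metric_structure"
  assumes "is_metric_structure M" "definable_in_vars M A V P"
    and "continuous_on {0..1} u" "u ` {0..1} \<subseteq> {0..1}"
  shows "definable_in_vars M A V (\<lambda>e. u (P e))"
proof (rule definable_in_vars_conn2[OF assms(1,2,2), of "\<lambda>s t. u s"])
  show "continuous_on ({0..1} \<times> {0..1}) (\<lambda>(s, t::real). u s)"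
    unfolding case_prod_unfold
    by (rule continuous_on_compose2[OF assms(3)]) (auto intro: continuous_on_fst continuous_on_id)
qed (use assms(4) in blast)

lemma definable_in_vars_max:
  fixes M :: "('m::complete_space, 'f, 'p) metric_structure"
  assumes "is_metric_structure M" "definable_in_vars M A V P" "definable_in_vars M A V Q"
  shows "definable_in_vars M A V (\<lambda>e. max (P e) (Q e))"
  by (rule definable_in_vars_conn2[OF assms])
    (auto simp: case_prod_unfold intro!: continuous_intros)

lemma abs_cSUP_diff_le:
  fixes f g :: "'a \<Rightarrow> real"
  assumes "bdd_above (range f)" "bdd_above (range g)" "\<And>a. \<bar>f a - g a\<bar> \<le> \<epsilon>"
  shows "\<bar>(SUP a. f a) - (SUP a. g a)\<bar> \<le> \<epsilon>"
proof -
  have "f a \<le> (SUP a. g a) + \<epsilon>" for a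
    using cSUP_upper[OF UNIV_I assms(2), of a] assms(3)[of a] by linarith
  then have "(SUP a. f a) \<le> (SUP a. g a) + \<epsilon>"
    by (intro cSUP_least) auto
  moreover have "g a \<le> (SUP a. f a) + \<epsilon>" for a
    using cSUP_upper[OF UNIV_I assms(1), of a] assms(3)[of a] by linarith
  then have "(SUP a. g a) \<le> (SUP a. f a) + \<epsilon>"
    by (intro cSUP_least) auto
  ultimately show ?thesis by linarith
qed

lemma definable_in_vars_SUP:
  fixes M :: "('m::complete_space, 'f, 'p) metric_structure"
  assumes metric_structure: "is_metric_structure M" and P_definable: "definable_in_vars M A V P"
  shows "definable_in_vars M A (V - {i}) (\<lambda>e. SUP a. P (e(i := a)))"
proof -
  obtain \<phi> where over: "\<And>k. fm_over M A (\<phi> k)" and free: "\<And>k. free_vars (\<phi> k) \<subseteq> V"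
    and lim: "uniform_limit UNIV (\<lambda>k e. fm_val M e (\<phi> k)) P sequentially"
    using P_definable by (rule definable_in_varsE) blast
  have bdd: "bdd_above (range (\<lambda>a. fm_val M (e(i := a)) (\<phi> k)))"
    "bdd_above (range (\<lambda>a. P (e(i := a))))" for e k
    using fm_val_in_unit[OF metric_structure over]
      definable_in_vars_in_unit[OF metric_structure P_definable]
    by (auto intro!: bdd_aboveI[of _ 1])
  have "uniform_limit UNIV (\<lambda>k e. fm_val M e (QSup i (\<phi> k)))
      (\<lambda>e. SUP a. P (e(i := a))) sequentially"
  proof (rule uniform_limitI)
    fix \<epsilon> :: real assume "\<epsilon> > 0"
    then have "\<forall>\<^sub>F k in sequentially. \<forall>e\<in>UNIV. dist (fm_val M e (\<phi> k)) (P e) < \<epsilon> / 2"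
      by (intro uniform_limitD[OF lim]) simp
    then show "\<forall>\<^sub>F k in sequentially. \<forall>e\<in>UNIV.
        dist (fm_val M e (QSup i (\<phi> k))) (SUP a. P (e(i := a))) < \<epsilon>"
    proof eventually_elim
      case (elim k)
      have "\<bar>fm_val M e (QSup i (\<phi> k)) - (SUP a. P (e(i := a)))\<bar> \<le> \<epsilon> / 2" for e
        unfolding fm_val.simps
        by (rule abs_cSUP_diff_le[OF bdd]) (use elim in \<open>auto simp: dist_real_def less_imp_le\<close>)
      moreover have "\<epsilon> / 2 < \<epsilon>" using \<open>\<epsilon> > 0\<close> by simp
      ultimately show ?case unfolding dist_real_def by (blast intro: le_less_trans)
    qed
  qed
  then show ?thesis
    by (rule definable_in_varsI[rotated 2]) (use over free in auto)
qed

lemma definable_in_vars_INF: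
  fixes M :: "('m::complete_space, 'f, 'p) metric_structure"
  assumes metric_structure: "is_metric_structure M" and P_definable: "definable_in_vars M A V P"
  shows "definable_in_vars M A (V - {i}) (\<lambda>e. INF a. P (e(i := a)))"
proof -
  have complement: "definable_in_vars M A W (\<lambda>e. 1 - Q e)" if "definable_in_vars M A W Q" for W Q
    by (rule definable_in_vars_conn1[OF metric_structure that, of "\<lambda>s. 1 - s"])
      (auto intro!: continuous_intros)
  have "(INF a. P (e(i := a))) = 1 - (SUP a. 1 - P (e(i := a)))" for e
  proof -
    have "bdd_above (range (\<lambda>a. - P (e(i := a))))"
      using definable_in_vars_in_unit[OF metric_structure P_definable]
      by (intro bdd_aboveI[of _ 0]) auto
    then have "(SUP a. 1 + - P (e(i := a))) = 1 + (SUP a. - P (e(i := a)))"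
      by (intro Sup_add_eq) auto
    then show ?thesis by (simp add: Inf_real_def image_image)
  qed
  moreover have "definable_in_vars M A (V - {i}) (\<lambda>e. 1 - (SUP a. 1 - P (e(i := a))))"
    by (intro complement definable_in_vars_SUP[OF metric_structure] P_definable)
  ultimately show ?thesis by simp
qed

section \<open>Definable sets\<close>

lemma definable_in_vars_infdist:
  "definable_set M A D \<Longrightarrow> definable_in_vars M A {i} (\<lambda>e. infdist (e i) D)"
  unfolding definable_set_def definable_pred_iff[of _ _ _ i] by blast

lemma definable_point_iff:
  "definable_point M A b \<longleftrightarrow> definable_in_vars M A {i} (\<lambda>e. dist (e i) b)"
  unfolding definable_point_def definable_set_def definable_pred_iff[of _ _ _ i] by simp

lemma infdist_le_one:
  assumes "\<And>x y::'a::metric_space. dist x y \<le> 1"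
  shows "infdist (x::'a) D \<le> 1"
proof (cases "D = {}")
  case False
  then show ?thesis using assms by (auto intro: infdist_le2)
qed (simp add: infdist_def)

lemma infdist_less_obtain:
  assumes "D \<noteq> {}" "infdist x D < \<epsilon>"
  obtains z where "z \<in> D" "dist x z < \<epsilon>"
  using assms unfolding infdist_notempty[OF assms(1)] by (auto dest!: cInf_lessD[rotated])

lemma penalized_infdist_bounds:
  fixes P :: "'a::metric_space \<Rightarrow> real"
  assumes bounded: "\<And>x y::'a. dist x y \<le> 1" and nonempty: "D \<noteq> {}"
    and nonneg: "\<And>x. 0 \<le> P x" and zero: "\<And>x. x \<in> D \<Longrightarrow> P x = 0"
    and small: "\<And>x. P x < \<delta> \<Longrightarrow> infdist x D \<le> \<epsilon>"
    and k_nonneg: "0 \<le> k" and k_large: "1 \<le> k * \<delta>"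
  shows "infdist x D - \<epsilon> \<le> (INF a. min 1 (dist x a + k * P a))"
    and "(INF a. min 1 (dist x a + k * P a)) \<le> infdist x D"
proof -
  have "0 \<le> \<epsilon>"
  proof -
    obtain d where "d \<in> D" using nonempty by blast
    moreover have "\<delta> > 0" using k_nonneg k_large mult_nonneg_nonpos[of k \<delta>] by linarith
    ultimately show ?thesis using small[of d] zero by simp
  qed
  have "infdist x D - \<epsilon> \<le> min 1 (dist x a + k * P a)" for a
  proof (cases "P a < \<delta>")
    case True
    then have "infdist x D \<le> dist x a + \<epsilon>"
      using small infdist_triangle[of x D a] by fastforce
    moreover have "0 \<le> k * P a" using k_nonneg nonneg by simp
    ultimately show ?thesis
      using infdist_le_one[OF bounded, of x D] \<open>0 \<le> \<epsilon>\<close> by linarith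
  next
    case False
    then have "k * \<delta> \<le> k * P a" using k_nonneg by (simp add: mult_left_mono)
    then have "min 1 (dist x a + k * P a) = 1" using k_large zero_le_dist[of x a] by linarith
    then show ?thesis using infdist_le_one[OF bounded, of x D] \<open>0 \<le> \<epsilon>\<close> by linarith
  qed
  then show "infdist x D - \<epsilon> \<le> (INF a. min 1 (dist x a + k * P a))"
    by (intro cINF_greatest) auto
  have bdd: "bdd_below (range (\<lambda>a. min 1 (dist x a + k * P a)))"
    using k_nonneg nonneg by (intro bdd_belowI[of _ 0]) auto
  have "(INF a. min 1 (dist x a + k * P a)) \<le> dist x d" if "d \<in> D" for d
    using cINF_lower[OF bdd, of d] zero[OF that] by simp
  then show "(INF a. min 1 (dist x a + k * P a)) \<le> infdist x D"
    unfolding infdist_notempty[OF nonempty] using nonempty by (intro cINF_greatest)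
qed

lemma uniform_limit_penalized_infdist:
  fixes P :: "'a::metric_space \<Rightarrow> real"
  assumes bounded: "\<And>x y::'a. dist x y \<le> 1" and nonempty: "D \<noteq> {}"
    and nonneg: "\<And>x. 0 \<le> P x" and zero: "\<And>x. x \<in> D \<Longrightarrow> P x = 0"
    and small: "\<And>\<epsilon>. \<epsilon> > 0 \<Longrightarrow> \<exists>\<delta>>0. \<forall>x. P x < \<delta> \<longrightarrow> infdist x D \<le> \<epsilon>"
  shows "uniform_limit UNIV (\<lambda>n x. INF a. min 1 (dist x a + real n * P a))
    (\<lambda>x. infdist x D) sequentially"
proof (rule uniform_limitI)
  fix \<epsilon> :: real assume "\<epsilon> > 0"
  then obtain \<delta> where \<delta>_pos: "\<delta> > 0" and \<delta>_small: "\<And>x. P x < \<delta> \<Longrightarrow> infdist x D \<le> \<epsilon> / 2"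
    using small[of "\<epsilon> / 2"] by auto
  have "\<forall>\<^sub>F n in sequentially. 1 / \<delta> \<le> real n"
    using filterlim_real_sequentially by (simp add: filterlim_at_top)
  then show "\<forall>\<^sub>F n in sequentially. \<forall>x\<in>UNIV.
      dist (INF a. min 1 (dist x a + real n * P a)) (infdist x D) < \<epsilon>"
  proof eventually_elim
    case (elim n)
    then have "1 \<le> real n * \<delta>" using \<delta>_pos by (simp add: pos_divide_le_eq)
    note bounds = penalized_infdist_bounds
      [where P = P, OF bounded nonempty nonneg zero \<delta>_small of_nat_0_le_iff this]
    have "dist (INF a. min 1 (dist x a + real n * P a)) (infdist x D) < \<epsilon>" for x
      unfolding dist_real_def using bounds[of x] \<open>\<epsilon> > 0\<close> by linarith
    then show ?case by blast
  qed
qed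

lemma definable_set_if_zero_set:
  fixes M :: "('m::complete_space, 'f, 'p) metric_structure"
  assumes metric_structure: "is_metric_structure M" and closed: "closed D" and nonempty: "D \<noteq> {}"
    and P_definable: "definable_pred M A P" and zero: "\<And>x. x \<in> D \<Longrightarrow> P x = 0"
    and small: "\<And>\<epsilon>. \<epsilon> > 0 \<Longrightarrow> \<exists>\<delta>>0. \<forall>x. P x < \<delta> \<longrightarrow> infdist x D \<le> \<epsilon>"
  shows "definable_set M A D"
proof -
  have P_in_vars: "definable_in_vars M A {i} (\<lambda>e. P (e i))" for i
    using P_definable by (simp only: definable_pred_iff[of _ _ _ i])
  have bounded: "\<And>x y::'m. dist x y \<le> 1"
    using metric_structure by (simp add: is_metric_structure_def)
  have nonneg: "0 \<le> P x" for x
    using definable_in_vars_in_unit[OF metric_structure P_in_vars, of "\<lambda>_. x"] by simp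
  have penalized: "definable_in_vars M A {0} (\<lambda>e. INF a. min 1 (dist (e 0) a + real n * P a))"
    for n
  proof -
    have "definable_in_vars M A {0, 1} (\<lambda>e. P (e 1))"
      using P_in_vars by (rule definable_in_vars_mono) simp
    then have "definable_in_vars M A {0, 1} (\<lambda>e. min 1 (dist (e 0) (e 1) + real n * P (e 1)))"
      by (rule definable_in_vars_conn2[OF metric_structure definable_in_vars_dist])
        (auto simp: case_prod_unfold intro!: continuous_intros)
    from definable_in_vars_INF[OF metric_structure this, of 1] show ?thesis
      by (simp add: insert_Diff_if)
  qed
  have "uniform_limit UNIV (\<lambda>n e. INF a. min 1 (dist (e 0) a + real n * P a))
      (\<lambda>e::nat \<Rightarrow> 'm. infdist (e 0) D) sequentially"
    using uniform_limit_compose'[OF uniform_limit_penalized_infdist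
        [OF bounded nonempty nonneg zero small], of "\<lambda>e. e 0"] by simp
  from definable_in_vars_uniform_limit[OF penalized this] show ?thesis
    using closed nonempty unfolding definable_set_def definable_pred_iff[of _ _ _ 0] by blast
qed

lemma compact_ball_gap:
  fixes D :: "'a::metric_space set"
  assumes "compact D" "closed (ball c \<epsilon>)"
  obtains \<eta> where "\<eta> < \<epsilon>" "\<And>y. y \<in> D \<Longrightarrow> dist c y < \<epsilon> \<Longrightarrow> dist c y \<le> \<eta>"
proof (cases "D \<inter> ball c \<epsilon> = {}")
  case True
  then show thesis by (intro that[of "\<epsilon> - 1"]) auto
next
  case False
  have "compact (D \<inter> ball c \<epsilon>)" using assms by (rule compact_Int_closed)
  moreover have "continuous_on (D \<inter> ball c \<epsilon>) (dist c)" by (intro continuous_intros)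
  ultimately obtain y where "y \<in> D \<inter> ball c \<epsilon>" "\<And>z. z \<in> D \<inter> ball c \<epsilon> \<Longrightarrow> dist c z \<le> dist c y"
    using continuous_attains_sup[OF _ False] by blast
  then show thesis by (intro that[of "dist c y"]) auto
qed

lemma definable_set_diff_ball:
  fixes M :: "('m::complete_space, 'f, 'p) metric_structure"
  assumes metric_structure: "is_metric_structure M"
    and compact: "compact D" and D_definable: "definable_set M A D"
    and c_definable: "definable_point M A c" and ball_closed: "closed (ball c \<epsilon>)"
    and nonempty: "D - ball c \<epsilon> \<noteq> {}"
  shows "definable_set M A (D - ball c \<epsilon>)"
proof -
  let ?P = "\<lambda>x. max (infdist x D) (min 1 (max 0 (\<epsilon> - dist x c)))"
  obtain \<eta> where \<eta>_less: "\<eta> < \<epsilon>" and gap: "\<And>y. y \<in> D \<Longrightarrow> dist c y < \<epsilon> \<Longrightarrow> dist c y \<le> \<eta>"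
    using compact_ball_gap[OF compact ball_closed] by blast
  show ?thesis
  proof (rule definable_set_if_zero_set[OF metric_structure _ nonempty])
    show "closed (D - ball c \<epsilon>)" using compact by (simp add: closed_Diff compact_imp_closed)
    have "definable_in_vars M A {0} (\<lambda>e. dist (e 0) c)"
      using c_definable by (simp add: definable_point_iff[of _ _ _ 0])
    then have "definable_in_vars M A {0} (\<lambda>e. min 1 (max 0 (\<epsilon> - dist (e 0) c)))"
      by (rule definable_in_vars_conn1[OF metric_structure]) (auto intro!: continuous_intros)
    then show "definable_pred M A ?P"
      unfolding definable_pred_iff[of _ _ _ 0]
      by (intro definable_in_vars_max[OF metric_structure] definable_in_vars_infdist D_definable)
    show "?P x = 0" if "x \<in> D - ball c \<epsilon>" for x
      using that by (simp add: dist_commute)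
    fix \<epsilon>' :: real assume "\<epsilon>' > 0"
    let ?\<delta> = "min \<epsilon>' (min 1 ((\<epsilon> - \<eta>) / 2))"
    have "infdist x (D - ball c \<epsilon>) \<le> \<epsilon>'" if "?P x < ?\<delta>" for x
    proof -
      have "D \<noteq> {}" using nonempty by blast
      moreover have "infdist x D < ?\<delta>" using that by linarith
      ultimately obtain z where "z \<in> D" and z_close: "dist x z < ?\<delta>"
        by (rule infdist_less_obtain)
      have "\<epsilon> - dist x c < ?\<delta>" using that by linarith
      then have "\<eta> < dist c z"
        using z_close dist_triangle[of x c z]
        by (simp add: dist_commute min_less_iff_conj field_simps)
      then have "z \<in> D - ball c \<epsilon>" using \<open>z \<in> D\<close> gap[of z] by auto
      then show ?thesis using z_close by (auto intro: infdist_le2)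
    qed
    then show "\<exists>\<delta>>0. \<forall>x. ?P x < \<delta> \<longrightarrow> infdist x (D - ball c \<epsilon>) \<le> \<epsilon>'"
      using \<open>\<epsilon>' > 0\<close> \<eta>_less by (intro exI[of _ ?\<delta>]) auto
  qed
qed

lemma definable_set_diff_balls:
  fixes M :: "('m::complete_space, 'f, 'p) metric_structure"
  assumes metric_structure: "is_metric_structure M"
    and compact: "compact D" and D_definable: "definable_set M A D"
    and finite: "finite F"
    and centres_definable: "\<And>c. c \<in> F \<Longrightarrow> definable_point M A c"
    and ball_closed: "\<And>c. c \<in> F \<Longrightarrow> closed (ball c \<epsilon>)"
    and nonempty: "D - (\<Union>c\<in>F. ball c \<epsilon>) \<noteq> {}"
  shows "definable_set M A (D - (\<Union>c\<in>F. ball c \<epsilon>))"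
  using finite centres_definable ball_closed nonempty
proof (induction F rule: finite_induct)
  case empty
  then show ?case using D_definable by simp
next
  case (insert c F)
  have diff_insert: "D - (\<Union>c\<in>insert c F. ball c \<epsilon>) = (D - (\<Union>c\<in>F. ball c \<epsilon>)) - ball c \<epsilon>" by blast
  have "compact (D - (\<Union>c\<in>F. ball c \<epsilon>))" using compact by (rule compact_diff) auto
  moreover have "definable_set M A (D - (\<Union>c\<in>F. ball c \<epsilon>))"
    using insert.prems by (intro insert.IH) auto
  ultimately show ?case
    unfolding diff_insert using insert.prems
    by (intro definable_set_diff_ball[OF metric_structure]) auto
qed

lemma closed_dcl: "closed (dcl M A)"
  unfolding closed_sequential_limits
proof (intro allI impI, elim conjE)
  fix c b assume c_in_dcl: "\<forall>n. c n \<in> dcl M A" and lim: "c \<longlonglongrightarrow> b"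
  have "uniform_limit UNIV (\<lambda>n e. dist (e 0) (c n)) (\<lambda>e::nat \<Rightarrow> _. dist (e 0) b) sequentially"
  proof (rule uniform_limitI)
    fix \<epsilon> :: real assume "\<epsilon> > 0"
    then have "\<forall>\<^sub>F n in sequentially. dist (c n) b < \<epsilon>" using lim by (rule tendstoD[rotated])
    then show "\<forall>\<^sub>F n in sequentially. \<forall>e\<in>UNIV. dist (dist (e (0::nat)) (c n)) (dist (e 0) b) < \<epsilon>"
    proof eventually_elim
      case (elim n)
      have "\<bar>dist x (c n) - dist x b\<bar> \<le> dist (c n) b" for x
        using dist_triangle[of x "c n" b] dist_triangle[of x b "c n"] by (simp add: dist_commute)
      then show ?case using elim by (auto simp: dist_real_def intro: le_less_trans)
    qed
  qed
  then have "definable_in_vars M A {0} (\<lambda>e. dist (e 0) b)"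
    by (rule definable_in_vars_uniform_limit[rotated])
      (use c_in_dcl in \<open>simp add: dcl_def definable_point_iff[of _ _ _ 0]\<close>)
  then show "b \<in> dcl M A"
    by (simp add: dcl_def definable_point_iff[of _ _ _ 0])
qed

section \<open>Metric linear orders\<close>

lemma dist_between_le_max:
  fixes a b c x :: "'m::metric_linear_order"
  assumes "a \<le> b" "b \<le> c"
  shows "dist x b \<le> max (dist x a) (dist x c)"
proof (rule ccontr)
  assume "\<not> ?thesis"
  then have "a \<in> {y. dist x y < dist x b}" "c \<in> {y. dist x y < dist x b}" by auto
  then have "b \<in> {y. dist x y < dist x b}"
    using order_convex_ball[of x "dist x b"] assms unfolding order_convex_def by blast
  then show False by simp
qed

lemma
  fixes a b c :: "'m::metric_linear_order"
  assumes "a \<le> b" "b \<le> c"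
  shows dist_mono_right: "dist a b \<le> dist a c"
    and dist_mono_left: "dist c b \<le> dist c a"
  using dist_between_le_max[OF assms, of a] dist_between_le_max[OF assms, of c] by simp_all

lemma ray_eq_infdist: "ray x y = infdist x {..y}"
  by (simp add: ray_def infdist_notempty)

lemma ray_eq_zero: "x \<le> y \<Longrightarrow> ray x y = 0"
  by (simp add: ray_eq_infdist)

lemma ray_eq_dist:
  assumes "y \<le> x"
  shows "ray x y = dist x y"
  unfolding ray_def by (rule cInf_eq_minimum) (use assms dist_mono_left in auto)

lemma ray_mono:
  assumes "a \<le> b"
  shows "ray a x \<le> ray b x"
proof (cases "a \<le> x")
  case True
  then show ?thesis by (simp add: ray_eq_zero ray_eq_infdist[of b] infdist_nonneg)
next
  case False
  then show ?thesis
    using assms dist_mono_right[of x a b] by (simp add: ray_eq_dist dist_commute)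
qed

lemma open_lessThan_metric_linear_order: "open {..<y::'m::metric_linear_order}"
  unfolding open_dist
proof
  fix x assume "x \<in> {..<y}"
  then have "x < y" by simp
  have "z < y" if "dist z x < dist x y" for z
    using that dist_mono_right[of x y z] \<open>x < y\<close> by (force simp: dist_commute)
  then show "\<exists>e>0. \<forall>z. dist z x < e \<longrightarrow> z \<in> {..<y}"
    using \<open>x < y\<close> by (intro exI[of _ "dist x y"]) auto
qed

lemma compact_has_greatest:
  fixes D :: "'m::metric_linear_order set"
  assumes "compact D" "D \<noteq> {}"
  obtains b where "b \<in> D" "D \<subseteq> {..b}"
proof (rule ccontr)
  assume "\<not> thesis"
  then have "\<forall>b\<in>D. \<exists>y\<in>D. b < y" using that by (meson atMost_iff not_le subsetI)
  then have "D \<subseteq> (\<Union>y\<in>D. {..<y})" by auto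
  then obtain F where "F \<subseteq> D" "finite F" and cover: "D \<subseteq> (\<Union>y\<in>F. {..<y})"
    by (rule compactE_image[OF assms(1) open_lessThan_metric_linear_order])
  then have "F \<noteq> {}" using assms(2) by auto
  then have "Max F \<in> D" using \<open>F \<subseteq> D\<close> \<open>finite F\<close> Max_in by blast
  then obtain y where "y \<in> F" "Max F < y" using cover by auto
  then show False using Max_ge[OF \<open>finite F\<close>] by (meson not_le)
qed

lemma dist_greatest_eq:
  fixes D :: "'m::metric_linear_order set"
  assumes "b \<in> D" "D \<subseteq> {..b}"
  shows "dist x b = max (infdist x D) (ray b x)"
proof (cases "x \<le> b")
  case True
  then show ?thesis using infdist_le[OF assms(1), of x] by (simp add: ray_eq_dist dist_commute)
next
  case False
  have "infdist x D = dist x b"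
    unfolding infdist_def using assms False
    by (auto intro!: cInf_eq_minimum dist_mono_left)
  then show ?thesis using False by (simp add: ray_eq_zero)
qed

text \<open>For a function that is \<open>1\<close>-Lipschitz in \<open>y\<close>, subtracting \<open>infdist y D\<close> turns the supremum over
  \<open>D\<close> into one over the whole structure, which a quantifier expresses.\<close>

lemma SUP_ray_minus_infdist:
  fixes D :: "'m::metric_linear_order set"
  assumes "b \<in> D" "D \<subseteq> {..b}"
  shows "(SUP y. max 0 (ray y x - infdist y D)) = ray b x"
proof (rule cSup_eq_maximum)
  have nonneg: "0 \<le> ray b x" by (simp add: ray_eq_infdist infdist_nonneg)
  then show "ray b x \<in> range (\<lambda>y. max 0 (ray y x - infdist y D))"
    using assms(1) by (intro range_eqI[of _ _ b]) simp
  have "ray y x - ray b x \<le> dist y d" if "d \<in> D" for y d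
    using infdist_triangle[of y "{..x}" d] ray_mono[of d b x] that assms(2)
    by (auto simp: ray_eq_infdist)
  then have "ray y x - ray b x \<le> infdist y D" for y
    using assms(1) unfolding infdist_def by (auto intro: cINF_greatest)
  then show "z \<le> ray b x" if "z \<in> range (\<lambda>y. max 0 (ray y x - infdist y D))" for z
    using that nonneg by (auto simp: algebra_simps)
qed

lemma definable_point_greatest:
  fixes M :: "('m::{metric_linear_order, complete_space}, 'f, 'p) metric_structure"
  assumes metric_structure: "is_metric_structure M" and ray_symbol: "has_ray_symbol M"
    and D_definable: "definable_set M A D"
    and greatest: "b \<in> D" "D \<subseteq> {..b}"
  shows "definable_point M A b"
proof -
  have "definable_in_vars M A {0, 1} (\<lambda>e. max 0 (ray (e 1) (e 0) - infdist (e 1) D))"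
  proof (rule definable_in_vars_conn2[OF metric_structure,
        of A "{0, 1}" _ _ "\<lambda>s t. max 0 (s - t)"])
    show "definable_in_vars M A {0, 1} (\<lambda>e. ray (e 1) (e 0))"
      using definable_in_vars_ray[OF ray_symbol] by (rule definable_in_vars_mono) auto
    show "definable_in_vars M A {0, 1} (\<lambda>e. infdist (e 1) D)"
      using definable_in_vars_infdist[OF D_definable] by (rule definable_in_vars_mono) auto
  qed (auto simp: case_prod_unfold intro!: continuous_intros)
  from definable_in_vars_SUP[OF metric_structure this, of 1]
  have "definable_in_vars M A {0} (\<lambda>e. ray b (e 0))"
    by (simp add: insert_Diff_if SUP_ray_minus_infdist[OF greatest])
  then have "definable_in_vars M A {0} (\<lambda>e. max (infdist (e 0) D) (ray b (e 0)))"
    by (intro definable_in_vars_max[OF metric_structure] definable_in_vars_infdist D_definable)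
  then show ?thesis
    by (simp add: definable_point_iff[of _ _ _ 0] dist_greatest_eq[OF greatest])
qed

section \<open>Definable and algebraic closure\<close>

lemma finite_ball_cover_subset_compact:
  fixes D :: "'a::metric_space set"
  assumes "compact D" "E \<subseteq> D" "\<epsilon> > 0"
  obtains F where "F \<subseteq> E" "finite F" "E \<subseteq> (\<Union>c\<in>F. ball c \<epsilon>)"
proof -
  have "compact (D \<inter> closure E)" using assms(1) by (simp add: compact_Int_closed)
  moreover have "D \<inter> closure E \<subseteq> (\<Union>c\<in>E. ball c \<epsilon>)"
  proof
    fix x assume "x \<in> D \<inter> closure E"
    then obtain c where "c \<in> E" "dist c x < \<epsilon>"
      using \<open>\<epsilon> > 0\<close> by (auto simp: closure_approachable)
    then show "x \<in> (\<Union>c\<in>E. ball c \<epsilon>)" by auto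
  qed
  ultimately obtain F where "F \<subseteq> E" "finite F" and cover: "D \<inter> closure E \<subseteq> (\<Union>c\<in>F. ball c \<epsilon>)"
    by (rule compactE_image[OF _ open_ball])
  moreover have "E \<subseteq> (\<Union>c\<in>F. ball c \<epsilon>)"
    using assms(2) closure_subset[of E] cover by (meson Int_greatest subset_trans)
  ultimately show thesis using that by blast
qed

lemma compact_definable_set_subset_dcl:
  fixes M :: "('m::{metric_linear_order, complete_space}, 'f, 'p) metric_structure"
  assumes metric_structure: "is_metric_structure M" and ray_symbol: "has_ray_symbol M"
    and ball_closed: "\<And>(c::'m) \<epsilon>. closed (ball c \<epsilon>)"
    and compact: "compact D" and D_definable: "definable_set M A D"
  shows "D \<subseteq> dcl M A"
proof -
  have "\<exists>c\<in>dcl M A. dist c b < \<epsilon>" if "b \<in> D" "\<epsilon> > 0" for b \<epsilon>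
  proof -
    obtain F where F_dcl: "F \<subseteq> D \<inter> dcl M A" and finite: "finite F"
      and cover: "D \<inter> dcl M A \<subseteq> (\<Union>c\<in>F. ball c \<epsilon>)"
      using finite_ball_cover_subset_compact[OF compact inf_le1 \<open>\<epsilon> > 0\<close>] .
    let ?D' = "D - (\<Union>c\<in>F. ball c \<epsilon>)"
    have "?D' = {}"
    proof (rule ccontr)
      assume nonempty: "?D' \<noteq> {}"
      have "definable_set M A ?D'"
        by (rule definable_set_diff_balls
              [OF metric_structure compact D_definable finite _ ball_closed nonempty])
          (use F_dcl in \<open>auto simp: dcl_def\<close>)
      moreover have "compact ?D'" using compact by (rule compact_diff) auto
      then obtain m where "m \<in> ?D'" "?D' \<subseteq> {..m}"
        using nonempty by (rule compact_has_greatest)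
      ultimately have "m \<in> dcl M A"
        unfolding dcl_def
        by (intro CollectI definable_point_greatest[OF metric_structure ray_symbol])
      then show False using \<open>m \<in> ?D'\<close> cover by blast
    qed
    then obtain c where "c \<in> F" "dist c b < \<epsilon>" using \<open>b \<in> D\<close> by auto
    then show ?thesis using F_dcl by blast
  qed
  then have "D \<subseteq> closure (dcl M A)" by (simp add: subset_iff closure_approachable)
  then show ?thesis by (simp add: closed_dcl)
qed

lemma dcl_subset_acl: "dcl M A \<subseteq> acl M A"
  unfolding acl_def dcl_def definable_point_def using compact_sing by blast

lemma closed_ball_udlo: "closed (ball (c::'m::udlo) \<epsilon>)"
proof (cases "\<epsilon> > 0")
  case True
  have "ball y \<epsilon> \<subseteq> - ball c \<epsilon>" if "y \<in> - ball c \<epsilon>" for y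
  proof
    fix z assume "z \<in> ball y \<epsilon>"
    then show "z \<in> - ball c \<epsilon>"
      using that ultrametric[of c y z] by (simp add: dist_commute)
  qed
  then show ?thesis
    unfolding closed_def open_contains_ball using True by blast
qed (simp add: ball_empty)

theorem theorem7p9:
  fixes M :: "('m::udlo, 'f, 'p) metric_structure" and A :: "'m set"
  assumes "weakly_o_minimal M"
  shows "(\<forall>D. compact D \<and> definable_set M A D \<longrightarrow> (\<forall>b\<in>D. definable_point M A b)) \<and>
         acl M A = dcl M A"
proof -
  have "is_metric_structure M" "has_ray_symbol M"
    using assms by (simp_all add: weakly_o_minimal_def)
  then have in_dcl: "D \<subseteq> dcl M A" if "compact D" "definable_set M A D" for D
    using that by (intro compact_definable_set_subset_dcl closed_ball_udlo)
  then have "definable_point M A b" if "compact D" "definable_set M A D" "b \<in> D" for D b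
    using that unfolding dcl_def by blast
  moreover have "acl M A = dcl M A"
    using in_dcl dcl_subset_acl[of M A] unfolding acl_def by blast
  ultimately show ?thesis by blast
qed

end
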